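(* Let $A$ be a real $n\times n$ matrix and $b\in\mathbb{R}^n$. Let $B=\{i\mid b[i]\neq 0\}$, $I=\{i\mid i\in \mathrm{reach}_{G(A)}(B),\ i\le n\}$ and $J=\{j-n\mid j\in \mathrm{reach}_{G(A)}(B),\ j> n\}$. If the system $Ax=b$ has a solution, then $A_{I,J}\,y=b_I$ has a solution, and for any solution $y$ of $A_{I,J}\,y=b_I$ the vector $\mathrm{lift}(y,J,n)$ is a solution of $Ax=b$.
   Context: For an $n\times n$ matrix $A$, $G(A)$ is the undirected graph with the $2n$ nodes $1,\dots,2n$ that has a link $(i,n+j)$ (for $1\le i,j\le n$) if and only if $A[i,j]\neq 0$. For a set $B$ of nodes, $\mathrm{reach}_{G(A)}(B)$ is the set of nodes reachable from some element of $B$ by a walk in $G(A)$ using at least one link (so a node of $B$ belongs to it only if it is incident to some link or is otherwise reached through links). Subsets of $\{1,\dots,n\}$ are regarded as increasing sequences (possibly empty). For such $I,J$, $A_{I,J}$ is the $|I|\times|J|$ matrix with $A_{I,J}[r,s]=A[I[r],J[s]]$, and $b_I$ is the vector with $b_I[r]=b[I[r]]$. For a vector $y$ of length $|J|$, $\mathrm{lift}(y,J,n)\in\mathbb{R}^n$ is the vector with $\mathrm{lift}(y,J,n)[i]=y[s]$ if $J[s]=i$, and $0$ if $i\notin J$. *)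

theory Defs
  imports
    "Jordan_Normal_Form.DL_Submatrix"
    "Graph_Theory.Pair_Digraph"
begin

text \<open>
  Matrices and vectors are indexed from 0, so all indices and nodes are shifted down by one
  against the usual 1-based convention: the rows of an \<open>n \<times> n\<close> matrix are the nodes
  \<open>0, \<dots>, n - 1\<close> and its column \<open>j < n\<close> is the node \<open>n + j\<close>. An undirected
  graph is a symmetric digraph: a link contributes both of its orientations as arcs.
\<close>

definition mat_graph :: "'a::zero mat \<Rightarrow> nat pair_pre_digraph" where
  "mat_graph A = (let n = dim_row A in
    \<lparr> pverts = {0..<2 * n},
      parcs = {(i, n + j) | i j. i < n \<and> j < n \<and> A $$ (i, j) \<noteq> 0}
            \<union> {(n + j, i) | i j. i < n \<and> j < n \<and> A $$ (i, j) \<noteq> 0} \<rparr>)"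

lemma pair_graph_mat_graph: "pair_graph (mat_graph A)"
proof -
  have sub: "parcs (mat_graph A) \<subseteq> {0..<2 * dim_row A} \<times> {0..<2 * dim_row A}"
    by (auto simp: mat_graph_def Let_def)
  have "finite (parcs (mat_graph A))"
    by (rule finite_subset[OF sub]) simp
  moreover have "symmetric (with_proj (mat_graph A))"
    by (auto simp: symmetric_def mat_graph_def Let_def sym_def)
  ultimately show ?thesis
    by unfold_locales (auto simp: mat_graph_def Let_def)
qed

text \<open>
  At least one arc is required, so a node of \<open>B\<close> without links is not in
  \<open>reach G B\<close>.
\<close>

definition reach :: "'v pair_pre_digraph \<Rightarrow> 'v set \<Rightarrow> 'v set" where
  "reach G B = {v. \<exists>u\<in>B. \<exists>p. p \<noteq> [] \<and> pre_digraph.awalk (with_proj G) u p v}"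

text \<open>
  For a finite set \<open>I\<close> and \<open>r < card I\<close>, \<open>pick I r\<close> is the entry at
  position \<open>r\<close> of \<open>I\<close> written as an increasing sequence; \<open>submatrix\<close>
  uses the same enumeration.
\<close>

definition subvec :: "'a vec \<Rightarrow> nat set \<Rightarrow> 'a vec" where
  "subvec b I = vec (card I) (\<lambda>r. b $ pick I r)"

definition lift :: "'a::zero vec \<Rightarrow> nat set \<Rightarrow> nat \<Rightarrow> 'a vec" where
  "lift y J n = vec n (\<lambda>i. if i \<in> J then y $ (THE s. s < card J \<and> pick J s = i) else 0)"

lemma lift_pick:
  assumes "J \<subseteq> {0..<n}" "s < card J"
  shows "lift y J n $ pick J s = y $ s"
proof -
  have "pick J s \<in> J" using assms(2) by (rule pick_in_set_le)
  moreover have "(THE s'. s' < card J \<and> pick J s' = pick J s) = s"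
  proof (rule the_equality)
    show "s' = s" if "s' < card J \<and> pick J s' = pick J s" for s'
      using that assms(2) card_pick_le[of s J] card_pick_le[of s' J] by simp
  qed (use assms(2) in simp)
  ultimately show ?thesis using assms(1) by (auto simp: lift_def)
qed

end

(* Walks never join a row node in I to a column node outside J or vice versa, so the rows in I vanish
   outside the columns J and the rows outside I vanish on the columns J. A row with a nonzero
   right-hand side has a nonzero entry since the system is solvable; walking along that link and
   back puts the row into I, so b vanishes outside I. Hence restricting a solution to J solves the
   subsystem, and a lifted solution of the subsystem satisfies the rows outside I trivially. *)
theory Submission
  imports Defs
begin

text \<open>A walk to \<open>v\<close> is extended by one arc. A node of \<open>B\<close> need not
  itself be in \<open>reach G B\<close>, so the case \<open>v \<in> B\<close> is separate: there the
  single arc is already the nonempty walk required.\<close>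

lemma reach_arcI:
  assumes "pair_wf_digraph G" "(v, w) \<in> parcs G" "v \<in> B \<or> v \<in> reach G B"
  shows "w \<in> reach G B"
proof -
  interpret pair_wf_digraph G by fact
  have arc: "awalk v [(v, w)] w"
    using arc_implies_awalk[of "(v, w)"] assms(2) by simp
  show ?thesis
  proof (cases "v \<in> B")
    case True
    then show ?thesis using arc unfolding reach_def by blast
  next
    case False
    then obtain u p where "u \<in> B" "awalk u p v"
      using assms(3) unfolding reach_def by blast
    then have "u \<in> B" "awalk u (p @ [(v, w)]) w"
      using arc by (auto intro: awalk_appendI)
    then show ?thesis unfolding reach_def by blast
  qed
qed

lemma reach_subset_pverts:
  assumes "pair_wf_digraph G"
  shows "reach G B \<subseteq> pverts G"
proof -
  interpret pair_wf_digraph G by fact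
  show ?thesis
    unfolding reach_def using awalk_last_in_verts by auto
qed

lemma pair_wf_digraph_mat_graph: "pair_wf_digraph (mat_graph A)"
  using pair_graph_mat_graph[of A] unfolding pair_graph_def pair_digraph_def pair_fin_digraph_def
  by blast

lemma bij_betw_pick:
  assumes "finite J"
  shows "bij_betw (pick J) {0..<card J} J"
proof (rule bij_betw_imageI)
  show "inj_on (pick J) {0..<card J}"
    by (rule inj_onI) (metis atLeastLessThan_iff card_pick_le)
  show "pick J ` {0..<card J} = J"
  proof
    show "pick J ` {0..<card J} \<subseteq> J"
      by (auto intro: pick_in_set_le)
    show "J \<subseteq> pick J ` {0..<card J}"
    proof
      fix j assume j: "j \<in> J"
      \<comment> \<open>The position of \<open>j\<close> in the increasing enumeration, counted from
        0, is the number of smaller elements of \<open>J\<close>.\<close>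
      then have "card {a \<in> J. a < j} < card J"
        using assms by (intro psubset_card_mono) auto
      then show "j \<in> pick J ` {0..<card J}"
        using pick_card_in_set[OF j] by (intro image_eqI[of _ _ "card {a \<in> J. a < j}"]) simp_all
    qed
  qed
qed

lemma sum_pick:
  assumes "finite J"
  shows "(\<Sum>s = 0..<card J. f (pick J s)) = sum f J"
  using bij_betw_pick[OF assms] by (rule sum.reindex_bij_betw)

lemma submatrix_carrier:
  assumes "A \<in> carrier_mat m n" "I \<subseteq> {0..<m}" "J \<subseteq> {0..<n}"
  shows "submatrix A I J \<in> carrier_mat (card I) (card J)"
proof -
  \<comment> \<open>\<open>submatrix\<close> counts only selected indices that are in range; here
    all of them are.\<close>
  have "{i. i < m \<and> i \<in> I} = I" "{j. j < n \<and> j \<in> J} = J" using assms by auto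
  then show ?thesis
    using assms(1) by (intro carrier_matI) (simp_all only: dim_submatrix carrier_matD)
qed

lemma submatrix_mult_vec_index:
  fixes A :: "'a::semiring_0 mat"
  assumes "A \<in> carrier_mat m n" "I \<subseteq> {0..<m}" "J \<subseteq> {0..<n}"
    and "y \<in> carrier_vec (card J)" "r < card I"
  shows "(submatrix A I J *\<^sub>v y) $ r = (\<Sum>s = 0..<card J. A $$ (pick I r, pick J s) * y $ s)"
proof -
  have "{i. i < dim_row A \<and> i \<in> I} = I" "{j. j < dim_col A \<and> j \<in> J} = J"
    using assms by auto
  then have "submatrix A I J $$ (r, s) = A $$ (pick I r, pick J s)" if "s < card J" for s
    using assms(5) that by (intro submatrix_index) (simp_all only:)
  then show ?thesis
    using submatrix_carrier[OF assms(1-3)] assms(4,5) by (simp add: scalar_prod_def)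
qed

text \<open>The lifted vector vanishes outside \<open>J\<close>, so each row product collapses to a
  sum over \<open>J\<close>, which \<open>pick\<close> reindexes by positions.\<close>

lemma mult_lift_index:
  fixes A :: "'a::semiring_0 mat"
  assumes "A \<in> carrier_mat m n" "J \<subseteq> {0..<n}" "i < m"
  shows "(A *\<^sub>v lift y J n) $ i = (\<Sum>s = 0..<card J. A $$ (i, pick J s) * y $ s)"
proof -
  have "(A *\<^sub>v lift y J n) $ i = (\<Sum>j = 0..<n. A $$ (i, j) * lift y J n $ j)"
    using assms by (simp add: scalar_prod_def lift_def)
  also have "\<dots> = (\<Sum>j\<in>J. A $$ (i, j) * lift y J n $ j)"
    using assms(2) by (intro sum.mono_neutral_right) (auto simp: lift_def)
  also have "\<dots> = (\<Sum>s = 0..<card J. A $$ (i, pick J s) * lift y J n $ pick J s)"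
    using assms(2) by (intro sum_pick[symmetric]) (rule finite_subset, auto)
  also have "\<dots> = (\<Sum>s = 0..<card J. A $$ (i, pick J s) * y $ s)"
    using assms(2) by (simp add: lift_pick)
  finally show ?thesis .
qed

text \<open>In a row of \<open>I\<close>, extending the sum from \<open>J\<close> to all columns
  adds only zero terms, by \<open>zero\<close>.\<close>

lemma submatrix_solution:
  fixes A :: "'a::semiring_0 mat"
  assumes A: "A \<in> carrier_mat m n" and I: "I \<subseteq> {0..<m}" and J: "J \<subseteq> {0..<n}"
    and zero: "\<And>i j. i \<in> I \<Longrightarrow> j < n \<Longrightarrow> j \<notin> J \<Longrightarrow> A $$ (i, j) = 0"
    and x: "x \<in> carrier_vec n"
  shows "submatrix A I J *\<^sub>v subvec x J = subvec (A *\<^sub>v x) I"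
proof (rule eq_vecI)
  fix r assume "r < dim_vec (subvec (A *\<^sub>v x) I)"
  then have r: "r < card I" by (simp add: subvec_def)
  then have i: "pick I r \<in> I" by (rule pick_in_set_le)
  have "(submatrix A I J *\<^sub>v subvec x J) $ r
      = (\<Sum>s = 0..<card J. A $$ (pick I r, pick J s) * x $ pick J s)"
    using submatrix_mult_vec_index[OF A I J _ r, of "subvec x J"] by (simp add: subvec_def)
  also have "\<dots> = (\<Sum>j\<in>J. A $$ (pick I r, j) * x $ j)"
    using J by (intro sum_pick) (rule finite_subset, auto)
  also have "\<dots> = (\<Sum>j = 0..<n. A $$ (pick I r, j) * x $ j)"
    using J zero[OF i] by (intro sum.mono_neutral_left) auto
  also have "\<dots> = subvec (A *\<^sub>v x) I $ r"
    using A I x i r by (auto simp: subvec_def scalar_prod_def intro!: sum.cong)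
  finally show "(submatrix A I J *\<^sub>v subvec x J) $ r = subvec (A *\<^sub>v x) I $ r" .
next
  show "dim_vec (submatrix A I J *\<^sub>v subvec x J) = dim_vec (subvec (A *\<^sub>v x) I)"
    using submatrix_carrier[OF A I J] by (simp add: subvec_def)
qed

text \<open>The rows in \<open>I\<close> are the equations of the subsystem. In any other row both
  sides are 0: the matrix vanishes on \<open>J\<close>, the lifted vector off
  \<open>J\<close>.\<close>

lemma lift_solution:
  fixes A :: "'a::semiring_0 mat"
  assumes A: "A \<in> carrier_mat m n" and I: "I \<subseteq> {0..<m}" and J: "J \<subseteq> {0..<n}"
    and zero: "\<And>i j. i < m \<Longrightarrow> i \<notin> I \<Longrightarrow> j \<in> J \<Longrightarrow> A $$ (i, j) = 0"
    and b: "b \<in> carrier_vec m" "\<And>i. i < m \<Longrightarrow> i \<notin> I \<Longrightarrow> b $ i = 0"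
    and y: "y \<in> carrier_vec (card J)" "submatrix A I J *\<^sub>v y = subvec b I"
  shows "A *\<^sub>v lift y J n = b"
proof (rule eq_vecI)
  fix i assume "i < dim_vec b"
  then have i: "i < m" using b by simp
  show "(A *\<^sub>v lift y J n) $ i = b $ i"
  proof (cases "i \<in> I")
    case True
    have "finite I" using I by (rule finite_subset) simp
    then have "i \<in> pick I ` {0..<card I}"
      using True by (simp only: bij_betw_imp_surj_on[OF bij_betw_pick])
    then obtain r where r: "r < card I" "pick I r = i" by auto
    have "(A *\<^sub>v lift y J n) $ i = (submatrix A I J *\<^sub>v y) $ r"
      using mult_lift_index[OF A J i] submatrix_mult_vec_index[OF A I J y(1) r(1)] r by simp
    also have "\<dots> = b $ i" using y(2) r by (simp add: subvec_def)
    finally show ?thesis .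
  next
    case False
    have "(A *\<^sub>v lift y J n) $ i = (\<Sum>s = 0..<card J. A $$ (i, pick J s) * y $ s)"
      by (rule mult_lift_index[OF A J i])
    also have "\<dots> = 0"
      using zero[OF i False] by (intro sum.neutral) (simp add: pick_in_set_le)
    finally show ?thesis using b(2)[OF i False] by simp
  qed
qed (use A b in simp)

theorem corollary1:
  fixes A :: "real mat" and b :: "real vec" and n :: nat and B I J :: "nat set"
  assumes "A \<in> carrier_mat n n" and "b \<in> carrier_vec n"
    and "B = {i. i < n \<and> b $ i \<noteq> 0}"
    and "I = {i. i \<in> reach (mat_graph A) B \<and> i < n}"
    and "J = {j - n | j. j \<in> reach (mat_graph A) B \<and> j \<ge> n}"
    and "\<exists>x \<in> carrier_vec n. A *\<^sub>v x = b"
  shows "(\<exists>y \<in> carrier_vec (card J). submatrix A I J *\<^sub>v y = subvec b I) \<and>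
    (\<forall>y \<in> carrier_vec (card J). submatrix A I J *\<^sub>v y = subvec b I \<longrightarrow>
      A *\<^sub>v lift y J n = b)"
proof -
  let ?G = "mat_graph A" and ?R = "reach (mat_graph A) B"
  note A = assms(1) and b = assms(2)
  obtain x where x: "x \<in> carrier_vec n" "A *\<^sub>v x = b" using assms(6) by blast
  have "?R \<subseteq> {0..<2 * n}"
    using reach_subset_pverts[OF pair_wf_digraph_mat_graph, of A B] A
    by (simp add: mat_graph_def Let_def)
  then have I: "I \<subseteq> {0..<n}" and J: "J \<subseteq> {0..<n}"
    using assms(4,5) by auto
  \<comment> \<open>The bound \<open>j \<ge> n\<close> in the definition of \<open>J\<close> makes
    the truncated subtraction invertible.\<close>
  have J_iff: "j \<in> J \<longleftrightarrow> n + j \<in> ?R" for j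
    unfolding assms(5) by (smt (verit) add_diff_cancel_left' le_add1 le_add_diff_inverse mem_Collect_eq)
  have arcs: "(i, n + j) \<in> parcs ?G" "(n + j, i) \<in> parcs ?G"
    if "i < n" "j < n" "A $$ (i, j) \<noteq> 0" for i j
    using that A by (auto simp: mat_graph_def Let_def)
  note reach_arcI = reach_arcI[OF pair_wf_digraph_mat_graph]
  \<comment> \<open>A link carries both orientations as arcs, so either both of its ends are reached
    or neither is. The two zero blocks below are the contrapositives.\<close>
  have I_J: "i \<in> I \<longleftrightarrow> j \<in> J" if "i < n" "j < n" "A $$ (i, j) \<noteq> 0" for i j
    using reach_arcI[OF arcs(1)[OF that]] reach_arcI[OF arcs(2)[OF that]] that(1)
    unfolding J_iff assms(4) by blast
  have zero: "A $$ (i, j) = 0" if "i \<in> I" "j < n" "j \<notin> J" for i j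
    using I_J[of i j] I that by (meson atLeastLessThan_iff subsetD)
  have zero': "A $$ (i, j) = 0" if "i < n" "i \<notin> I" "j \<in> J" for i j
    using I_J[of i j] J that by (meson atLeastLessThan_iff subsetD)
  have b_zero: "b $ i = 0" if i: "i < n" "i \<notin> I" for i
  proof (rule ccontr)
    assume "b $ i \<noteq> 0"
    then have "i \<in> B" using assms(3) i by simp
    \<comment> \<open>Solvability enters here: the sum is \<open>b $ i\<close>, so row
      \<open>i\<close> cannot be zero and node \<open>i\<close> has a link.\<close>
    have "(\<Sum>j = 0..<n. A $$ (i, j) * x $ j) \<noteq> 0"
      using \<open>b $ i \<noteq> 0\<close> x A i by (auto simp: scalar_prod_def)
    then obtain j where "j < n" "A $$ (i, j) \<noteq> 0"
      by (metis (no_types, lifting) atLeastLessThan_iff mult_zero_left sum.neutral)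
    note j = i(1) this
    \<comment> \<open>The walk leaves \<open>i\<close> along this link; \<open>I_J\<close> then
      brings it back, so \<open>i\<close> would be in \<open>I\<close>.\<close>
    have "n + j \<in> ?R" using reach_arcI[OF arcs(1)[OF j]] \<open>i \<in> B\<close> by blast
    then show False using I_J[OF j] J_iff i by blast
  qed
  \<comment> \<open>The witness for the subsystem is the restriction to \<open>J\<close> of the
    given solution \<open>x\<close>.\<close>
  have "submatrix A I J *\<^sub>v subvec x J = subvec b I"
    using submatrix_solution[OF A I J zero x(1)] x(2) by simp
  moreover have "subvec x J \<in> carrier_vec (card J)" by (simp add: subvec_def)
  moreover have "A *\<^sub>v lift y J n = b"
    if "y \<in> carrier_vec (card J)" "submatrix A I J *\<^sub>v y = subvec b I" for y
    using lift_solution[OF A I J zero' b b_zero that] .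
  ultimately show ?thesis by blast
qed

end
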